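(* Let $K(s)$ be continuous. There exists a 2-parameter family of pseudo-isotropic parabolic revolution surfaces of i-type in $\mathbb{I}^3_{\mathrm{p}}$ (with parameters $a,b,c,c_1,c_2\in\mathbb{R}$, $ac_1+bc_2\neq0$) with $K$ as the Gaussian curvature (i.e. the Gaussian curvature at the point with parameters $(s,t)$ is $K(s)$) and whose generating curves $\alpha_{k_0,k_1}(s)$, where $s$ is an arc-length parameter, satisfy $$z(s)=k_0+k_1s+\frac{c_1^2\,s^2}{2(ac_1+bc_2)}-\frac{B^2}{ac_1+bc_2}\int_{s_0}^{s}\int_{s_0}^{v}K(w)\,dw\,dv,$$ where $k_0,k_1$ are constants depending on the values of $z,z'$ at $s=s_0$, $B=b$ if $\alpha_{k_0,k_1}(s)=(s,0,z(s))$, and $B=a$ if $\alpha_{k_0,k_1}(s)=(0,s,z(s))$ (with $B\neq0$ in each case, by admissibility).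
   Context: The pseudo-isotropic space $\mathbb{I}^3_{\mathrm{p}}$ is $\mathbb{R}^3$ with the degenerate metric $\langle u,v\rangle_{pz}=u^1v^1-u^2v^2$. For a $C^2$ parameterized surface $\mathbf{x}(u^1,u^2)=(x^1,x^2,x^3)$ write $\mathbf{x}_i=\partial\mathbf{x}/\partial u^i$, $\mathbf{x}_{ij}=\partial^2\mathbf{x}/\partial u^i\partial u^j$, $x^i_k=\partial x^i/\partial u^k$, $X_{ij}=x^i_1x^j_2-x^j_1x^i_2$. The surface is admissible if $X_{12}\neq0$ (equivalently, the induced metric has rank 2). Put $g_{ij}=\langle\mathbf{x}_i,\mathbf{x}_j\rangle_{pz}$, $N_h=\left(\frac{X_{23}}{X_{12}},\frac{X_{13}}{X_{12}},1\right)$, $h_{ij}=\langle N_h,\mathbf{x}_{ij}\rangle_1$, where $\langle u,v\rangle_1=u^1v^1-u^2v^2+u^3v^3$. The Gaussian curvature is $$K=\frac{h_{11}h_{22}-h_{12}^2}{g_{11}g_{22}-g_{12}^2};$$ equivalently $K=\det L$ with $L=-D\xi^{\mathrm p}$, $\xi^{\mathrm p}=\left(\alpha_1,\alpha_2,\frac12(1-\alpha_1^2+\alpha_2^2)\right)$, $\alpha_1=X_{23}/X_{12}$, $\alpha_2=X_{13}/X_{12}$. The parabolic revolution surfaces of i-type with parameters $a,b,c,c_1,c_2$, where $ac_1+bc_2\neq0$, are, with coordinates $(u^1,u^2)=(u,t)$ and $C^2$ generating curve $\alpha$: for $\alpha(u)=(x(u),0,z(u))$ (spacelike), $$Zh_3(u,t)=\left(at+x(u),\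 bt,\ ct+\tfrac{ac_1+bc_2}{2}t^2+c_1t\,x(u)+z(u)\right),$$ and for $\alpha(u)=(0,y(u),z(u))$ (timelike), $$Wh_3(u,t)=\left(at,\ bt+y(u),\ ct+\tfrac{ac_1+bc_2}{2}t^2+c_2t\,y(u)+z(u)\right).$$ They are admissible when $bx'\neq0$, respectively $ay'\neq0$; surfaces are assumed admissible.
   Formalization: In the case α=(0,s,z(s)), B=a, the term c_1^2 s^2 is corrected to c_2^2 s^2: as printed, with K=0, a=c_1=1, b=c=c_2=0, the surface has curvature -1. The case α=(s,0,z(s)) is as printed. *)

theory Defs
  imports "HOL-Analysis.Analysis"
begin

(* The degenerate metric of the pseudo-isotropic space I^3_p, and the auxiliary
   non-degenerate form that enters the second fundamental form. *)
definition pz :: "real^3 \<Rightarrow> real^3 \<Rightarrow> real" where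
  "pz u v = u $ 1 * v $ 1 - u $ 2 * v $ 2"

definition inner_1 :: "real^3 \<Rightarrow> real^3 \<Rightarrow> real" where
  "inner_1 u v = u $ 1 * v $ 1 - u $ 2 * v $ 2 + u $ 3 * v $ 3"

type_synonym surface = "real \<Rightarrow> real \<Rightarrow> real^3"

definition pd1 :: "surface \<Rightarrow> surface" where
  "pd1 X u v = vector_derivative (\<lambda>s. X s v) (at u)"

definition pd2 :: "surface \<Rightarrow> surface" where
  "pd2 X u v = vector_derivative (\<lambda>t. X u t) (at v)"

(* Only meant for open parameter domains U. *)
definition C1_surface_on :: "(real \<times> real) set \<Rightarrow> surface \<Rightarrow> bool" where
  "C1_surface_on U X \<longleftrightarrow>
     (\<forall>(u, v)\<in>U. (\<lambda>s. X s v) differentiable (at u) \<and> (\<lambda>t. X u t) differentiable (at v)) \<and>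
     continuous_on U (\<lambda>(u, v). pd1 X u v) \<and> continuous_on U (\<lambda>(u, v). pd2 X u v)"

definition C2_surface_on :: "(real \<times> real) set \<Rightarrow> surface \<Rightarrow> bool" where
  "C2_surface_on U X \<longleftrightarrow>
     C1_surface_on U X \<and> C1_surface_on U (pd1 X) \<and> C1_surface_on U (pd2 X)"

definition minor :: "surface \<Rightarrow> 3 \<Rightarrow> 3 \<Rightarrow> real \<Rightarrow> real \<Rightarrow> real" where
  "minor X i j u v = pd1 X u v $ i * pd2 X u v $ j - pd1 X u v $ j * pd2 X u v $ i"

definition admissible_on :: "(real \<times> real) set \<Rightarrow> surface \<Rightarrow> bool" where
  "admissible_on U X \<longleftrightarrow> (\<forall>(u, v)\<in>U. minor X 1 2 u v \<noteq> 0)"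

definition N_h :: "surface \<Rightarrow> surface" where
  "N_h X u v =
     vector [minor X 2 3 u v / minor X 1 2 u v, minor X 1 3 u v / minor X 1 2 u v, 1]"

definition gauss_curvature :: "surface \<Rightarrow> real \<Rightarrow> real \<Rightarrow> real" where
  "gauss_curvature X u v =
     (let g11 = pz (pd1 X u v) (pd1 X u v);
          g12 = pz (pd1 X u v) (pd2 X u v);
          g22 = pz (pd2 X u v) (pd2 X u v);
          h11 = inner_1 (N_h X u v) (pd1 (pd1 X) u v);
          h12 = inner_1 (N_h X u v) (pd2 (pd1 X) u v);
          h22 = inner_1 (N_h X u v) (pd2 (pd2 X) u v)
      in (h11 * h22 - h12\<^sup>2) / (g11 * g22 - g12\<^sup>2))"

definition C2_curve_on :: "real set \<Rightarrow> (real \<Rightarrow> real^3) \<Rightarrow> bool" where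
  "C2_curve_on I \<alpha> \<longleftrightarrow>
     \<alpha> C1_differentiable_on I \<and> (\<lambda>s. vector_derivative \<alpha> (at s)) C1_differentiable_on I"

definition spacelike_on :: "real set \<Rightarrow> (real \<Rightarrow> real^3) \<Rightarrow> bool" where
  "spacelike_on I \<alpha> \<longleftrightarrow>
     (\<forall>s\<in>I. pz (vector_derivative \<alpha> (at s)) (vector_derivative \<alpha> (at s)) > 0)"

definition timelike_on :: "real set \<Rightarrow> (real \<Rightarrow> real^3) \<Rightarrow> bool" where
  "timelike_on I \<alpha> \<longleftrightarrow>
     (\<forall>s\<in>I. pz (vector_derivative \<alpha> (at s)) (vector_derivative \<alpha> (at s)) < 0)"

definition arc_length_param_on :: "real set \<Rightarrow> (real \<Rightarrow> real^3) \<Rightarrow> bool" where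
  "arc_length_param_on I \<alpha> \<longleftrightarrow>
     (\<forall>s\<in>I. \<bar>pz (vector_derivative \<alpha> (at s)) (vector_derivative \<alpha> (at s))\<bar> = 1)"

(* Parabolic revolution surfaces of i-type, generated by a curve of the form
   (x(u), 0, z(u)) for Zh3 and (0, y(u), z(u)) for Wh3; the remaining component of
   the generating curve is not used. *)
definition Zh3 :: "real \<Rightarrow> real \<Rightarrow> real \<Rightarrow> real \<Rightarrow> real \<Rightarrow> (real \<Rightarrow> real^3) \<Rightarrow> surface" where
  "Zh3 a b c c1 c2 \<alpha> u t =
     vector [a * t + \<alpha> u $ 1,
             b * t,
             c * t + (a * c1 + b * c2) / 2 * t\<^sup>2 + c1 * t * \<alpha> u $ 1 + \<alpha> u $ 3]"

definition Wh3 :: "real \<Rightarrow> real \<Rightarrow> real \<Rightarrow> real \<Rightarrow> real \<Rightarrow> (real \<Rightarrow> real^3) \<Rightarrow> surface" where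
  "Wh3 a b c c1 c2 \<alpha> u t =
     vector [a * t,
             b * t + \<alpha> u $ 2,
             c * t + (a * c1 + b * c2) / 2 * t\<^sup>2 + c2 * t * \<alpha> u $ 2 + \<alpha> u $ 3]"

end

theory Submission
  imports Defs
begin

text \<open>
  Both kinds of surface have the same shape: a generating curve \<open>(e1 s, e2 s, z s)\<close> gives
  \<open>(e1 s + a t, e2 s + b t, c t + D t\<^sup>2 / 2 + d t s + z s)\<close> with \<open>D = a c1 + b c2\<close>, where
  \<open>(e1, e2, d)\<close> is \<open>(1, 0, c1)\<close> in the spacelike and \<open>(0, 1, c2)\<close> in the timelike case.
  The first two coordinates are affine in the parameters. Hence all second partial
  derivatives are vertical, and as \<open>N_h\<close> has third coordinate 1, the second
  fundamental form is simply the Hessian of the third coordinate, with entries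
  \<open>z''\<close>, \<open>d\<close>, \<open>D\<close>. The first fundamental form is constant with determinant \<open>- m\<^sup>2\<close>, where
  \<open>m = e1 b - e2 a\<close> is the minor whose non-vanishing is admissibility. So
  \<open>K = (d\<^sup>2 - D z'') / m\<^sup>2\<close> (lemma \<open>gauss_curvature_parabolic_graph\<close>).

  For a prescribed continuous \<open>K\<close> this is the linear equation
  \<open>z'' = (d\<^sup>2 - m\<^sup>2 K) / D\<close>, and two integrations, justified by the fundamental theorem of
  calculus on an open interval (lemma \<open>interval_integral_has_derivative\<close>), give the
  stated profile. The pair of initial values of \<open>z\<close> is an invertible affine image of
  \<open>(k0, k1)\<close>, so the family has two genuine parameters.
\<close>

section \<open>Vectors in three-space given by coordinates\<close>

lemma vector_3_eq_sum_axis: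
  "(vector [x, y, z] :: real^3) = x *\<^sub>R axis 1 1 + y *\<^sub>R axis 2 1 + z *\<^sub>R axis 3 1"
  by (simp add: vec_eq_iff forall_3 axis_def)

lemma has_vector_derivative_vector_3:
  assumes "(f has_real_derivative f') (at x)" "(g has_real_derivative g') (at x)"
    "(h has_real_derivative h') (at x)"
  shows "((\<lambda>s. vector [f s, g s, h s] :: real^3) has_vector_derivative vector [f', g', h']) (at x)"
  unfolding vector_3_eq_sum_axis
  by (intro has_vector_derivative_add)
    (auto intro!: derivative_eq_intros assms)

lemma continuous_on_vector_3:
  fixes f g h :: "'a::topological_space \<Rightarrow> real"
  assumes "continuous_on S f" "continuous_on S g" "continuous_on S h"
  shows "continuous_on S (\<lambda>x. vector [f x, g x, h x] :: real^3)"
  unfolding vector_3_eq_sum_axis by (intro continuous_intros assms)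

section \<open>Partial derivatives on open parameter domains\<close>

text \<open>
  A formula for \<open>pd1 X\<close> or \<open>pd2 X\<close> is known on the domain \<open>U\<close> alone. To differentiate a second
  time, the partial derivatives are named explicitly and carried over to \<open>pd1 X\<close> and \<open>pd2 X\<close>
  by agreement on the open set \<open>U\<close>.
\<close>

definition has_partials_on :: "(real \<times> real) set \<Rightarrow> surface \<Rightarrow> surface \<Rightarrow> surface \<Rightarrow> bool" where
  "has_partials_on U X P Q \<longleftrightarrow>
     (\<forall>u v. (u, v) \<in> U \<longrightarrow>
        ((\<lambda>s. X s v) has_vector_derivative P u v) (at u) \<and>
        ((\<lambda>t. X u t) has_vector_derivative Q u v) (at v))"

lemma has_partials_on_pd:
  assumes "has_partials_on U X P Q" "(u, v) \<in> U"
  shows "pd1 X u v = P u v" "pd2 X u v = Q u v"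
  using assms by (auto simp: has_partials_on_def pd1_def pd2_def intro!: vector_derivative_at)

lemma has_partials_on_cong:
  assumes "open U" and X: "has_partials_on U X P Q"
    and eq: "\<And>u v. (u, v) \<in> U \<Longrightarrow> Y u v = X u v"
  shows "has_partials_on U Y P Q"
  unfolding has_partials_on_def
proof (intro allI impI conjI)
  fix u v assume uv: "(u, v) \<in> U"
  have o1: "open ((\<lambda>s. (s, v)) -` U)" and o2: "open (Pair u -` U)"
    using \<open>open U\<close> by (auto intro!: open_vimage continuous_intros)
  show "((\<lambda>s. Y s v) has_vector_derivative P u v) (at u)"
    by (rule has_vector_derivative_transform_within_open[OF _ o1])
      (use X uv eq in \<open>auto simp: has_partials_on_def\<close>)
  show "((\<lambda>t. Y u t) has_vector_derivative Q u v) (at v)"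
    by (rule has_vector_derivative_transform_within_open[OF _ o2])
      (use X uv eq in \<open>auto simp: has_partials_on_def\<close>)
qed

lemma C1_surface_onI:
  assumes X: "has_partials_on U X P Q"
    and "continuous_on U (\<lambda>(u, v). P u v)" "continuous_on U (\<lambda>(u, v). Q u v)"
  shows "C1_surface_on U X"
proof -
  have "continuous_on U (\<lambda>(u, v). pd1 X u v)"
    using assms(2) by (rule continuous_on_eq) (auto simp: has_partials_on_pd[OF X])
  moreover have "continuous_on U (\<lambda>(u, v). pd2 X u v)"
    using assms(3) by (rule continuous_on_eq) (auto simp: has_partials_on_pd[OF X])
  ultimately show ?thesis
    using X unfolding C1_surface_on_def has_partials_on_def
    by (auto intro: differentiableI_vector)
qed

section \<open>Surfaces generated by parabolas in vertical planes\<close>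

text \<open>
  The common form of the spacelike and timelike revolution surfaces: the motion acts in
  the direction \<open>(a, b)\<close> and the generating curve lies over the line spanned by \<open>(e1, e2)\<close>.
\<close>

definition parabolic_graph ::
  "real \<Rightarrow> real \<Rightarrow> real \<Rightarrow> real \<Rightarrow> real \<Rightarrow> real \<Rightarrow> real \<Rightarrow> (real \<Rightarrow> real) \<Rightarrow> surface" where
  "parabolic_graph e1 e2 a b c d D z s t =
     vector [e1 * s + a * t, e2 * s + b * t, c * t + D / 2 * t\<^sup>2 + d * t * s + z s]"

lemma Zh3_eq_parabolic_graph:
  assumes "\<And>s. \<alpha> s = vector [s, 0, z s]"
  shows "Zh3 a b c c1 c2 \<alpha> = parabolic_graph 1 0 a b c c1 (a * c1 + b * c2) z"
  by (auto simp: fun_eq_iff Zh3_def parabolic_graph_def assms vec_eq_iff forall_3)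

lemma Wh3_eq_parabolic_graph:
  assumes "\<And>s. \<alpha> s = vector [0, s, z s]"
  shows "Wh3 a b c c1 c2 \<alpha> = parabolic_graph 0 1 a b c c2 (a * c1 + b * c2) z"
  by (auto simp: fun_eq_iff Wh3_def parabolic_graph_def assms vec_eq_iff forall_3)

context
  fixes I :: "real set" and z z' z'' :: "real \<Rightarrow> real"
  assumes I: "open I"
    and z: "\<And>s. s \<in> I \<Longrightarrow> (z has_real_derivative z' s) (at s)"
    and z': "\<And>s. s \<in> I \<Longrightarrow> (z' has_real_derivative z'' s) (at s)"
    and z'': "continuous_on I z''"
begin

lemma has_partials_on_parabolic_graph:
  "has_partials_on (I \<times> UNIV) (parabolic_graph e1 e2 a b c d D z)
     (\<lambda>s t. vector [e1, e2, d * t + z' s]) (\<lambda>s t. vector [a, b, c + D * t + d * s])"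
  unfolding has_partials_on_def parabolic_graph_def
  by (auto intro!: has_vector_derivative_vector_3 derivative_eq_intros z)

lemma has_partials_on_pd_parabolic_graph:
  shows "has_partials_on (I \<times> UNIV) (pd1 (parabolic_graph e1 e2 a b c d D z))
      (\<lambda>s t. vector [0, 0, z'' s]) (\<lambda>s t. vector [0, 0, d])"
    and "has_partials_on (I \<times> UNIV) (pd2 (parabolic_graph e1 e2 a b c d D z))
      (\<lambda>s t. vector [0, 0, d]) (\<lambda>s t. vector [0, 0, D])"
proof -
  have U: "open (I \<times> (UNIV :: real set))"
    using I by (simp add: open_Times)
  have "has_partials_on (I \<times> UNIV) (\<lambda>s t. vector [e1, e2, d * t + z' s])
      (\<lambda>s t. vector [0, 0, z'' s]) (\<lambda>s t. vector [0, 0, d])"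
    unfolding has_partials_on_def
    by (auto intro!: has_vector_derivative_vector_3 derivative_eq_intros z')
  then show "has_partials_on (I \<times> UNIV) (pd1 (parabolic_graph e1 e2 a b c d D z))
      (\<lambda>s t. vector [0, 0, z'' s]) (\<lambda>s t. vector [0, 0, d])"
    by (rule has_partials_on_cong[OF U]) (rule has_partials_on_pd[OF has_partials_on_parabolic_graph])
  have "has_partials_on (I \<times> UNIV) (\<lambda>s t. vector [a, b, c + D * t + d * s])
      (\<lambda>s t. vector [0, 0, d]) (\<lambda>s t. vector [0, 0, D])"
    unfolding has_partials_on_def
    by (auto intro!: has_vector_derivative_vector_3 derivative_eq_intros)
  then show "has_partials_on (I \<times> UNIV) (pd2 (parabolic_graph e1 e2 a b c d D z))
      (\<lambda>s t. vector [0, 0, d]) (\<lambda>s t. vector [0, 0, D])"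
    by (rule has_partials_on_cong[OF U]) (rule has_partials_on_pd[OF has_partials_on_parabolic_graph])
qed

lemma C2_surface_on_parabolic_graph:
  "C2_surface_on (I \<times> UNIV) (parabolic_graph e1 e2 a b c d D z)"
proof -
  have "continuous_on I z'"
    using z' by (meson DERIV_isCont continuous_at_imp_continuous_on)
  then have Z': "continuous_on (I \<times> UNIV) (\<lambda>p::real \<times> real. z' (fst p))"
    by (rule continuous_on_compose2[OF _ continuous_on_fst[OF continuous_on_id]]) auto
  have Z'': "continuous_on (I \<times> UNIV) (\<lambda>p::real \<times> real. z'' (fst p))"
    using z'' by (rule continuous_on_compose2[OF _ continuous_on_fst[OF continuous_on_id]]) auto
  have "C1_surface_on (I \<times> UNIV) (parabolic_graph e1 e2 a b c d D z)"
    by (rule C1_surface_onI[OF has_partials_on_parabolic_graph]; unfold case_prod_beta)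
      (intro continuous_on_vector_3 continuous_intros Z')+
  moreover have "C1_surface_on (I \<times> UNIV) (pd1 (parabolic_graph e1 e2 a b c d D z))"
    by (rule C1_surface_onI[OF has_partials_on_pd_parabolic_graph(1)]; unfold case_prod_beta)
      (intro continuous_on_vector_3 continuous_intros Z'')+
  moreover have "C1_surface_on (I \<times> UNIV) (pd2 (parabolic_graph e1 e2 a b c d D z))"
    by (rule C1_surface_onI[OF has_partials_on_pd_parabolic_graph(2)]; unfold case_prod_beta)
      (intro continuous_on_vector_3 continuous_intros)+
  ultimately show ?thesis
    by (simp add: C2_surface_on_def)
qed

lemma minor_parabolic_graph:
  assumes "s \<in> I"
  shows "minor (parabolic_graph e1 e2 a b c d D z) 1 2 s t = e1 * b - e2 * a"
  using assms by (simp add: minor_def has_partials_on_pd[OF has_partials_on_parabolic_graph])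

text \<open>
  Every second partial derivative is a multiple of the third coordinate vector, whose
  pairing with \<open>N_h\<close> is 1. The denominator is the Gram determinant of \<open>(e1, e2)\<close> and
  \<open>(a, b)\<close> for a form of signature \<open>(1, 1)\<close>, hence minus the square of their area.
\<close>

lemma gauss_curvature_parabolic_graph:
  assumes "s \<in> I"
  shows "gauss_curvature (parabolic_graph e1 e2 a b c d D z) s t =
    (d\<^sup>2 - D * z'' s) / (e1 * b - e2 * a)\<^sup>2"
proof -
  have st: "(s, t) \<in> I \<times> UNIV" using assms by simp
  have "gauss_curvature (parabolic_graph e1 e2 a b c d D z) s t =
      (z'' s * D - d\<^sup>2) / ((e1\<^sup>2 - e2\<^sup>2) * (a\<^sup>2 - b\<^sup>2) - (e1 * a - e2 * b)\<^sup>2)"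
    unfolding gauss_curvature_def has_partials_on_pd[OF has_partials_on_parabolic_graph st]
      has_partials_on_pd[OF has_partials_on_pd_parabolic_graph(1) st]
      has_partials_on_pd[OF has_partials_on_pd_parabolic_graph(2) st]
    by (simp add: pz_def inner_1_def N_h_def power2_eq_square Let_def)
  also have "(e1\<^sup>2 - e2\<^sup>2) * (a\<^sup>2 - b\<^sup>2) - (e1 * a - e2 * b)\<^sup>2 = - ((e1 * b - e2 * a)\<^sup>2)"
    by algebra
  also have "(z'' s * D - d\<^sup>2) / - ((e1 * b - e2 * a)\<^sup>2) =
      (d\<^sup>2 - D * z'' s) / (e1 * b - e2 * a)\<^sup>2"
    by (simp add: minus_divide_right[symmetric] minus_divide_left mult.commute)
  finally show ?thesis .
qed

lemma has_vector_derivative_profile: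
  assumes "s \<in> I"
  shows "((\<lambda>s. vector [e1 * s, e2 * s, z s] :: real^3)
    has_vector_derivative vector [e1, e2, z' s]) (at s)"
  using assms by (auto intro!: has_vector_derivative_vector_3 derivative_eq_intros z)

lemma C2_curve_on_profile:
  "C2_curve_on I (\<lambda>s. vector [e1 * s, e2 * s, z s])"
proof -
  have z'_cont: "continuous_on I z'"
    using z' by (meson DERIV_isCont continuous_at_imp_continuous_on)
  have second: "((\<lambda>s. vector_derivative (\<lambda>s. vector [e1 * s, e2 * s, z s] :: real^3) (at s))
      has_vector_derivative vector [0, 0, z'' s]) (at s)" if "s \<in> I" for s
  proof (rule has_vector_derivative_transform_within_open[OF _ I that])
    show "((\<lambda>s. vector [e1, e2, z' s] :: real^3) has_vector_derivative vector [0, 0, z'' s]) (at s)"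
      using that by (auto intro!: has_vector_derivative_vector_3 derivative_eq_intros z')
  qed (simp add: vector_derivative_at[OF has_vector_derivative_profile])
  have cont: "continuous_on I (\<lambda>s. vector [e1, e2, z' s] :: real^3)"
    "continuous_on I (\<lambda>s. vector [0, 0, z'' s] :: real^3)"
    by (intro continuous_on_vector_3 continuous_on_const z'_cont z'')+
  show ?thesis
    unfolding C2_curve_on_def C1_differentiable_on_def
    by (intro conjI exI[of _ "\<lambda>s. vector [e1, e2, z' s]"] exI[of _ "\<lambda>s. vector [0, 0, z'' s]"]
          ballI has_vector_derivative_profile second cont)
qed

end

section \<open>Profiles with prescribed second derivative\<close>

lemma interval_integral_has_derivative:
  fixes f :: "real \<Rightarrow> real"
  assumes "open I" "is_interval I" "s0 \<in> I" "continuous_on I f" "s \<in> I"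
  shows "((\<lambda>s. LBINT v=s0..s. f v) has_real_derivative f s) (at s)"
proof -
  \<comment> \<open>Openness leaves room for a compact interval inside \<open>I\<close> with \<open>s\<close> in its interior.\<close>
  obtain e where "e > 0" and e: "cball s e \<subseteq> I"
    using assms by (auto simp: open_contains_cball)
  define l r where "l = min s0 (s - e)" and "r = max s0 (s + e)"
  have "s - e \<in> I" "s + e \<in> I"
    using e \<open>e > 0\<close> by (auto simp: subset_iff dist_real_def)
  then have "l \<in> I" "r \<in> I"
    using \<open>s0 \<in> I\<close> by (auto simp: l_def r_def min_def max_def)
  then have "{l..r} \<subseteq> I"
    by (meson \<open>is_interval I\<close> atLeastAtMost_iff mem_is_interval_1_I subsetI)
  then have "continuous_on {l..r} f"
    using assms continuous_on_subset by blast
  moreover have "l \<le> s0" "s0 \<le> r" "l < s" "s < r"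
    using \<open>e > 0\<close> by (auto simp: l_def r_def)
  ultimately have "((\<lambda>s. LBINT v=s0..s. f v) has_vector_derivative f s) (at s within {l..r})"
    by (intro interval_integral_FTC2) auto
  moreover have "at s within {l..r} = at s"
    using \<open>l < s\<close> \<open>s < r\<close> by (rule at_within_Icc_at)
  ultimately show ?thesis
    by (simp add: has_real_derivative_iff_has_vector_derivative)
qed

definition profile :: "(real \<Rightarrow> real) \<Rightarrow> real \<Rightarrow> real \<Rightarrow> real \<Rightarrow> real \<Rightarrow> real \<Rightarrow> real \<Rightarrow> real \<Rightarrow> real" where
  "profile K s0 d D m k0 k1 s = k0 + k1 * s + d\<^sup>2 * s\<^sup>2 / (2 * D)
     - m\<^sup>2 / D * (LBINT v=s0..s. (LBINT w=s0..v. K w))"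

definition profile_slope :: "(real \<Rightarrow> real) \<Rightarrow> real \<Rightarrow> real \<Rightarrow> real \<Rightarrow> real \<Rightarrow> real \<Rightarrow> real \<Rightarrow> real" where
  "profile_slope K s0 d D m k1 s = k1 + d\<^sup>2 * s / D - m\<^sup>2 / D * (LBINT w=s0..s. K w)"

lemma profile_derivs:
  assumes "open I" "is_interval I" "s0 \<in> I" "continuous_on I K" and D: "D \<noteq> 0" and "s \<in> I"
  shows "(profile K s0 d D m k0 k1 has_real_derivative profile_slope K s0 d D m k1 s) (at s)"
    and "(profile_slope K s0 d D m k1 has_real_derivative (d\<^sup>2 - m\<^sup>2 * K s) / D) (at s)"
proof -
  note FTC = interval_integral_has_derivative[OF assms(1-3)]
  have "continuous_on I (\<lambda>v. LBINT w=s0..v. K w)"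
    using FTC[OF assms(4)] by (meson DERIV_isCont continuous_at_imp_continuous_on)
  note J = FTC[OF this \<open>s \<in> I\<close>]
  show "(profile K s0 d D m k0 k1 has_real_derivative profile_slope K s0 d D m k1 s) (at s)"
    unfolding profile_def profile_slope_def
    using D by (auto intro!: derivative_eq_intros J simp: field_simps)
  show "(profile_slope K s0 d D m k1 has_real_derivative (d\<^sup>2 - m\<^sup>2 * K s) / D) (at s)"
    unfolding profile_slope_def
    using D by (auto intro!: derivative_eq_intros FTC[OF assms(4) \<open>s \<in> I\<close>] simp: field_simps)
qed

text \<open>
  At \<open>s0\<close> both integrals vanish, so the initial values depend on \<open>(k0, k1)\<close> through a
  unipotent triangular affine map.
\<close>

lemma bij_profile_initial_values:
  assumes "open I" "is_interval I" "s0 \<in> I" "continuous_on I K" "D \<noteq> 0"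
  shows "bij (\<lambda>(k0, k1). (profile K s0 d D m k0 k1 s0, deriv (profile K s0 d D m k0 k1) s0))"
proof -
  have "profile K s0 d D m k0 k1 s0 = k0 + k1 * s0 + d\<^sup>2 * s0\<^sup>2 / (2 * D)"
    "deriv (profile K s0 d D m k0 k1) s0 = k1 + d\<^sup>2 * s0 / D" for k0 k1
    using DERIV_imp_deriv[OF profile_derivs(1)[OF assms \<open>s0 \<in> I\<close>]]
    by (simp_all add: profile_def profile_slope_def)
  then show ?thesis
    by (intro bij_betw_byWitness[where f' = "\<lambda>(p, q).
          (p - (q - d\<^sup>2 * s0 / D) * s0 - d\<^sup>2 * s0\<^sup>2 / (2 * D), q - d\<^sup>2 * s0 / D)"]) auto
qed

section \<open>Revolution surfaces with prescribed curvature\<close>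

text \<open>
  The arc-length normalisation and the causal character are read off the horizontal
  direction \<open>(e1, e2)\<close>: the metric does not see the third coordinate.
\<close>

lemma profile_curve:
  fixes K :: "real \<Rightarrow> real" and e1 e2 d m k0 k1 :: real
  assumes I: "open I" "is_interval I" "s0 \<in> I" "continuous_on I K" and D: "D \<noteq> 0"
  defines "\<gamma> \<equiv> (\<lambda>s. vector [e1 * s, e2 * s, profile K s0 d D m k0 k1 s] :: real^3)"
  shows "C2_curve_on I \<gamma>"
    and "e1\<^sup>2 - e2\<^sup>2 = 1 \<Longrightarrow> spacelike_on I \<gamma>"
    and "e1\<^sup>2 - e2\<^sup>2 = -1 \<Longrightarrow> timelike_on I \<gamma>"
    and "\<bar>e1\<^sup>2 - e2\<^sup>2\<bar> = 1 \<Longrightarrow> arc_length_param_on I \<gamma>"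
proof -
  have "continuous_on I (\<lambda>s. (d\<^sup>2 - m\<^sup>2 * K s) / D)"
    by (intro continuous_intros I(4)) (use D in auto)
  note hyps = I(1) profile_derivs[OF I D, of _ d m] this
  show "C2_curve_on I \<gamma>"
    unfolding \<gamma>_def by (rule C2_curve_on_profile[OF hyps])
  have pz: "pz (vector_derivative \<gamma> (at s)) (vector_derivative \<gamma> (at s)) = e1\<^sup>2 - e2\<^sup>2"
    if "s \<in> I" for s
    unfolding \<gamma>_def
    by (simp add: vector_derivative_at[OF has_vector_derivative_profile[OF hyps that]]
          pz_def power2_eq_square)
  show "e1\<^sup>2 - e2\<^sup>2 = 1 \<Longrightarrow> spacelike_on I \<gamma>"
    by (simp add: spacelike_on_def pz)
  show "e1\<^sup>2 - e2\<^sup>2 = -1 \<Longrightarrow> timelike_on I \<gamma>"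
    by (simp add: timelike_on_def pz)
  show "\<bar>e1\<^sup>2 - e2\<^sup>2\<bar> = 1 \<Longrightarrow> arc_length_param_on I \<gamma>"
    by (simp add: arc_length_param_on_def pz)
qed

text \<open>
  The profile's second derivative was chosen to solve the curvature equation. Allowing \<open>m\<close> to
  be the minor up to sign covers the timelike case, where the minor is \<open>- a\<close>.
\<close>

lemma prescribed_curvature_parabolic_graph:
  fixes K :: "real \<Rightarrow> real" and c d k0 k1 :: real
  assumes I: "open I" "is_interval I" "s0 \<in> I" "continuous_on I K" and D: "D \<noteq> 0"
    and m: "(e1 * b - e2 * a)\<^sup>2 = m\<^sup>2" "m \<noteq> 0"
  defines "X \<equiv> parabolic_graph e1 e2 a b c d D (profile K s0 d D m k0 k1)"
  shows "C2_surface_on (I \<times> UNIV) X"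
    and "admissible_on (I \<times> UNIV) X"
    and "\<forall>s\<in>I. \<forall>t. gauss_curvature X s t = K s"
proof -
  have "continuous_on I (\<lambda>s. (d\<^sup>2 - m\<^sup>2 * K s) / D)"
    by (intro continuous_intros I(4)) (use D in auto)
  note hyps = I(1) profile_derivs[OF I D, of _ d m] this
  show "C2_surface_on (I \<times> UNIV) X"
    unfolding X_def by (rule C2_surface_on_parabolic_graph[OF hyps])
  have "e1 * b - e2 * a \<noteq> 0" using m by auto
  then show "admissible_on (I \<times> UNIV) X"
    unfolding X_def admissible_on_def by (auto simp: minor_parabolic_graph[OF hyps])
  show "\<forall>s\<in>I. \<forall>t. gauss_curvature X s t = K s"
    unfolding X_def using m D by (simp add: gauss_curvature_parabolic_graph[OF hyps])
qed

theorem theorem6p6: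
  fixes K :: "real \<Rightarrow> real" and I :: "real set" and s0 a b c c1 c2 :: real
  assumes "open I" and "is_interval I" and "s0 \<in> I"
    and "continuous_on I K"
    and "a * c1 + b * c2 \<noteq> 0"
  shows
    "(b \<noteq> 0 \<longrightarrow>
       (\<exists>\<alpha> :: real \<Rightarrow> real \<Rightarrow> real \<Rightarrow> real^3.
          (\<forall>k0 k1.
             C2_curve_on I (\<alpha> k0 k1) \<and>
             spacelike_on I (\<alpha> k0 k1) \<and>
             arc_length_param_on I (\<alpha> k0 k1) \<and>
             C2_surface_on (I \<times> UNIV) (Zh3 a b c c1 c2 (\<alpha> k0 k1)) \<and>
             admissible_on (I \<times> UNIV) (Zh3 a b c c1 c2 (\<alpha> k0 k1)) \<and>
             (\<forall>s\<in>I. \<forall>t. gauss_curvature (Zh3 a b c c1 c2 (\<alpha> k0 k1)) s t = K s) \<and>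
             (\<forall>s\<in>I. \<alpha> k0 k1 s =
                vector [s, 0,
                  k0 + k1 * s + c1\<^sup>2 * s\<^sup>2 / (2 * (a * c1 + b * c2))
                  - b\<^sup>2 / (a * c1 + b * c2) * (LBINT v=s0..s. (LBINT w=s0..v. K w))])) \<and>
          bij (\<lambda>(k0, k1). (\<alpha> k0 k1 s0 $ 3, deriv (\<lambda>s. \<alpha> k0 k1 s $ 3) s0))))
     \<and>
     (a \<noteq> 0 \<longrightarrow>
       (\<exists>\<alpha> :: real \<Rightarrow> real \<Rightarrow> real \<Rightarrow> real^3.
          (\<forall>k0 k1.
             C2_curve_on I (\<alpha> k0 k1) \<and>
             timelike_on I (\<alpha> k0 k1) \<and>
             arc_length_param_on I (\<alpha> k0 k1) \<and>
             C2_surface_on (I \<times> UNIV) (Wh3 a b c c1 c2 (\<alpha> k0 k1)) \<and>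
             admissible_on (I \<times> UNIV) (Wh3 a b c c1 c2 (\<alpha> k0 k1)) \<and>
             (\<forall>s\<in>I. \<forall>t. gauss_curvature (Wh3 a b c c1 c2 (\<alpha> k0 k1)) s t = K s) \<and>
             (\<forall>s\<in>I. \<alpha> k0 k1 s =
                vector [0, s,
                  k0 + k1 * s + c2\<^sup>2 * s\<^sup>2 / (2 * (a * c1 + b * c2))
                  - a\<^sup>2 / (a * c1 + b * c2) * (LBINT v=s0..s. (LBINT w=s0..v. K w))])) \<and>
          bij (\<lambda>(k0, k1). (\<alpha> k0 k1 s0 $ 3, deriv (\<lambda>s. \<alpha> k0 k1 s $ 3) s0))))"
proof -
  note I = assms(1-4) and D = assms(5)
  let ?D = "a * c1 + b * c2"
  let "(_ \<longrightarrow> (\<exists>\<alpha>. ?Z \<alpha>)) \<and> (_ \<longrightarrow> (\<exists>\<alpha>. ?W \<alpha>))" = ?thesis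
  have "\<exists>\<alpha>. ?Z \<alpha>" if "b \<noteq> 0"
  proof -
    let ?z = "profile K s0 c1 ?D b"
    define \<alpha> :: "real \<Rightarrow> real \<Rightarrow> real \<Rightarrow> real^3"
      where "\<alpha> = (\<lambda>k0 k1 s. vector [s, 0, ?z k0 k1 s])"
    have surface: "Zh3 a b c c1 c2 (\<alpha> k0 k1) = parabolic_graph 1 0 a b c c1 ?D (?z k0 k1)"
      for k0 k1
      by (rule Zh3_eq_parabolic_graph) (simp add: \<alpha>_def)
    have curve: "\<alpha> k0 k1 = (\<lambda>s. vector [1 * s, 0 * s, ?z k0 k1 s])" for k0 k1
      by (simp add: \<alpha>_def)
    note C = profile_curve[OF I D, of 1 0 c1 b, folded curve]
    have "(1 * b - 0 * a)\<^sup>2 = b\<^sup>2" by simp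
    note S = prescribed_curvature_parabolic_graph[where c = c and d = c1, OF I D this that,
        folded surface]
    have bij: "bij (\<lambda>(k0, k1). (\<alpha> k0 k1 s0 $ 3, deriv (\<lambda>s. \<alpha> k0 k1 s $ 3) s0))"
      using bij_profile_initial_values[OF I D, of c1 b] by (simp add: \<alpha>_def)
    have eq: "\<alpha> k0 k1 s = vector [s, 0, k0 + k1 * s + c1\<^sup>2 * s\<^sup>2 / (2 * ?D)
        - b\<^sup>2 / ?D * (LBINT v=s0..s. (LBINT w=s0..v. K w))]" for k0 k1 s
      by (simp only: \<alpha>_def profile_def)
    have arc: "spacelike_on I (\<alpha> k0 k1)" "arc_length_param_on I (\<alpha> k0 k1)" for k0 k1
      by (rule C(2), simp, rule C(4), simp)
    have "?Z \<alpha>"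
      by (intro conjI allI ballI C(1) arc S(1,2) S(3)[rule_format] eq bij)
    then show ?thesis
      by (rule exI[of _ \<alpha>])
  qed
  moreover
  have "\<exists>\<alpha>. ?W \<alpha>" if "a \<noteq> 0"
  proof -
    let ?z = "profile K s0 c2 ?D a"
    define \<alpha> :: "real \<Rightarrow> real \<Rightarrow> real \<Rightarrow> real^3"
      where "\<alpha> = (\<lambda>k0 k1 s. vector [0, s, ?z k0 k1 s])"
    have surface: "Wh3 a b c c1 c2 (\<alpha> k0 k1) = parabolic_graph 0 1 a b c c2 ?D (?z k0 k1)"
      for k0 k1
      by (rule Wh3_eq_parabolic_graph) (simp add: \<alpha>_def)
    have curve: "\<alpha> k0 k1 = (\<lambda>s. vector [0 * s, 1 * s, ?z k0 k1 s])" for k0 k1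
      by (simp add: \<alpha>_def)
    note C = profile_curve[OF I D, of 0 1 c2 a, folded curve]
    have "(0 * b - 1 * a)\<^sup>2 = a\<^sup>2" by simp
    note S = prescribed_curvature_parabolic_graph[where c = c and d = c2, OF I D this that,
        folded surface]
    have bij: "bij (\<lambda>(k0, k1). (\<alpha> k0 k1 s0 $ 3, deriv (\<lambda>s. \<alpha> k0 k1 s $ 3) s0))"
      using bij_profile_initial_values[OF I D, of c2 a] by (simp add: \<alpha>_def)
    have eq: "\<alpha> k0 k1 s = vector [0, s, k0 + k1 * s + c2\<^sup>2 * s\<^sup>2 / (2 * ?D)
        - a\<^sup>2 / ?D * (LBINT v=s0..s. (LBINT w=s0..v. K w))]" for k0 k1 s
      by (simp only: \<alpha>_def profile_def)
    have arc: "timelike_on I (\<alpha> k0 k1)" "arc_length_param_on I (\<alpha> k0 k1)" for k0 k1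
      by (rule C(3), simp, rule C(4), simp)
    have "?W \<alpha>"
      by (intro conjI allI ballI C(1) arc S(1,2) S(3)[rule_format] eq bij)
    then show ?thesis
      by (rule exI[of _ \<alpha>])
  qed
  ultimately show ?thesis by blast
qed

end
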